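(* For all integers $n\ge 1$ and $0\le k\le n-1$, $$|PF_{n,k}| = \sum_{\sigma\in S_n}\left(\prod_{i=1}^n \ell_k(i;\sigma)\right).$$
   Context: Write $[n]=\{1,\dots,n\}$. A street has parking spots $1,\dots,n$ in order, and cars $c_1,\dots,c_n$ arrive in this order. A parking preference is a tuple $\alpha=(a_1,\dots,a_n)\in[n]^n$, where $a_i$ is the preferred spot of $c_i$. $k$-Naples parking rule: car $c_i$ drives to spot $a_i$; if it is empty, $c_i$ parks there. If it is occupied, $c_i$ backs up one spot at a time, checking spots $a_i-1,a_i-2,\dots$ in turn, up to at most $k$ spots behind $a_i$ (and never past spot $1$), and parks in the first empty one it finds. If all of these spots are occupied, $c_i$ goes forward and parks in the first empty spot after $a_i$, if there is one; otherwise it fails to park. The preference $\alpha$ is a $k$-Naples parking function of length $n$ if all $n$ cars park under this rule; $PF_{n,k}$ is the set of all of these. $S_n$ is the symmetric group on $[n]$, with permutations in one-line notation. For $\sigma=s_1\cdots s_n\in S_n$ and $1\le i\le n$ (subsequences here are blocks of consecutive entries): - $\mathtt{left}_k(i;\sigma)$ is the length of the longest subsequence $s_j\cdots s_{i-1}$ such that $s_t<s_i$ for all $j\le t<i$ (equal to $0$ if it is empty). - $\mathtt{right}_k(i;\sigma)$ is the length of the longest subsequence $s_i\cdots s_r$ such that $r\le i+k$ (and $r\le n$) and $s_t\le s_i$ for all $i\le t\le r$. - $\ell_k(i;\sigma)=\mathtt{left}_k(i;\sigma)+\mathtt{right}_k(i;\sigma)$ if $\mathtt{left}_k(i;\sigma)=i-1$,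 and $\ell_k(i;\sigma)=\max(\mathtt{left}_k(i;\sigma)-k,0)+\mathtt{right}_k(i;\sigma)$ if $\mathtt{left}_k(i;\sigma)<i-1$. *)

theory Defs
  imports Complex_Main "HOL-Combinatorics.Permutations"
begin

text \<open>
  The spots a car preferring spot \<open>a\<close> checks, in this order: \<open>a\<close> itself; then
  \<open>a - 1, a - 2, \<dots>\<close>, at most \<open>k\<close> of them and never below \<open>1\<close>; then \<open>a + 1, \<dots>, n\<close>.
\<close>
definition check_order :: "nat \<Rightarrow> nat \<Rightarrow> nat \<Rightarrow> nat list" where
  "check_order n k a = [a] @ rev [max 1 (a - k)..<a] @ [a + 1..<n + 1]"

definition naples_spot :: "nat \<Rightarrow> nat \<Rightarrow> nat set \<Rightarrow> nat \<Rightarrow> nat option" where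
  "naples_spot n k occ a = find (\<lambda>s. s \<notin> occ) (check_order n k a)"

fun all_park :: "nat \<Rightarrow> nat \<Rightarrow> nat set \<Rightarrow> nat list \<Rightarrow> bool" where
  "all_park n k occ [] = True"
| "all_park n k occ (a # as) =
     (case naples_spot n k occ a of
        None \<Rightarrow> False
      | Some s \<Rightarrow> all_park n k (insert s occ) as)"

definition parking_preferences :: "nat \<Rightarrow> nat list set" where
  "parking_preferences n = {\<alpha>. length \<alpha> = n \<and> set \<alpha> \<subseteq> {1..n}}"

definition PF :: "nat \<Rightarrow> nat \<Rightarrow> nat list set" where
  "PF n k = {\<alpha> \<in> parking_preferences n. all_park n k {} \<alpha>}"

text \<open>
  A permutation \<open>\<sigma>\<close> of \<open>{1..n}\<close> has one-line notation \<open>\<sigma> 1, \<dots>, \<sigma> n\<close>. The block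
  \<open>\<sigma> j, \<dots>, \<sigma> (i - 1)\<close> has length \<open>i - j\<close> and is empty for \<open>j = i\<close>. The number
  \<open>left\<^sub>k(i;\<sigma>)\<close> does not depend on \<open>k\<close>.
\<close>
definition left_len :: "nat \<Rightarrow> (nat \<Rightarrow> nat) \<Rightarrow> nat" where
  "left_len i \<sigma> = Max {i - j | j. 1 \<le> j \<and> j \<le> i \<and> (\<forall>t. j \<le> t \<and> t < i \<longrightarrow> \<sigma> t < \<sigma> i)}"

definition right_len :: "nat \<Rightarrow> nat \<Rightarrow> nat \<Rightarrow> (nat \<Rightarrow> nat) \<Rightarrow> nat" where
  "right_len n k i \<sigma> =
     Max {r - i + 1 | r. i \<le> r \<and> r \<le> i + k \<and> r \<le> n \<and> (\<forall>t. i \<le> t \<and> t \<le> r \<longrightarrow> \<sigma> t \<le> \<sigma> i)}"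

text \<open>Truncated subtraction on \<^typ>\<open>nat\<close> renders \<open>max(left\<^sub>k(i;\<sigma>) - k, 0)\<close>.\<close>
definition ell :: "nat \<Rightarrow> nat \<Rightarrow> nat \<Rightarrow> (nat \<Rightarrow> nat) \<Rightarrow> nat" where
  "ell n k i \<sigma> =
     (if left_len i \<sigma> = i - 1 then left_len i \<sigma> + right_len n k i \<sigma>
      else (left_len i \<sigma> - k) + right_len n k i \<sigma>)"

end

theory Submission
  imports Defs "HOL-Combinatorics.Multiset_Permutations"
begin

text \<open>
  Classify the parking functions by their outcome, the list of the spots taken by
  \<open>c\<^sub>1, \<dots>, c\<^sub>n\<close>. The occupied set before each arrival is determined by the outcome, so
  the number of parking functions with a given outcome is a product of the numbers of
  preferences that send the arriving car to its spot. In terms of the permutation \<open>\<sigma>\<close> with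
  \<open>\<sigma> i\<close> the index of the car on spot \<open>i\<close>, the occupied set when spot \<open>i\<close> is taken is
  \<open>{t. \<sigma> t < \<sigma> i}\<close>, and the preferences leading to \<open>i\<close> form one interval ending at \<open>i - 1\<close>
  (cars going forward) and one starting at \<open>i\<close> (cars parking at once or backing up), whose
  lengths add up to \<open>\<ell>\<^sub>k(i;\<sigma>)\<close>.
\<close>

section \<open>The spot taken by a single car\<close>

lemma find_append:
  "find P (xs @ ys) = (case find P xs of None \<Rightarrow> find P ys | Some x \<Rightarrow> Some x)"
  by (induction xs) auto

lemma find_upt_eq_Some_iff:
  "find P [a..<b] = Some s \<longleftrightarrow> a \<le> s \<and> s < b \<and> P s \<and> (\<forall>t\<in>{a..<s}. \<not> P t)"
proof (induction b arbitrary: s)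
  case (Suc b)
  show ?case
  proof (cases "find P [a..<b]")
    case None
    then have "\<forall>t\<in>{a..<b}. \<not> P t"
      by (simp add: find_None_iff)
    then show ?thesis
      using None by (auto simp: find_append less_Suc_eq)
  next
    case (Some t)
    then show ?thesis
      using Suc.IH[of t] Suc.IH[of s]
      by (auto simp: find_append less_Suc_eq)
  qed
qed auto

lemma find_rev_upt_eq_Some_iff:
  "find P (rev [a..<b]) = Some s \<longleftrightarrow> a \<le> s \<and> s < b \<and> P s \<and> (\<forall>t\<in>{s<..<b}. \<not> P t)"
  by (induction b) (auto simp: less_Suc_eq)

text \<open>In either direction the spots checked before \<open>s\<close> fill one interval adjacent
  to \<open>s\<close>: a car going forward has already checked the spots behind \<open>a\<close> and
  \<open>a\<close> itself, which join up with \<open>{a<..<s}\<close>. Parking at once is the case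
  of an empty \<open>{s<..a}\<close>.\<close>

lemma naples_spot_eq_Some_iff:
  assumes "a \<in> {1..n}"
  shows "naples_spot n k occ a = Some s \<longleftrightarrow>
    s \<in> {1..n} - occ \<and>
    (s \<le> a \<and> a \<le> s + k \<and> {s<..a} \<subseteq> occ \<or> a < s \<and> {max 1 (a - k)..<s} \<subseteq> occ)"
proof -
  let ?m = "max 1 (a - k)"
  let ?f = "find (\<lambda>s. s \<notin> occ)"
  have none: "?f (rev [?m..<a]) = None \<longleftrightarrow> {?m..<a} \<subseteq> occ"
    by (auto simp: find_None_iff subset_iff)
  have "naples_spot n k occ a = Some s \<longleftrightarrow> s = a \<and> a \<notin> occ \<or>
      a \<in> occ \<and> ?f (rev [?m..<a]) = Some s \<or>
      a \<in> occ \<and> ?f (rev [?m..<a]) = None \<and> ?f [a + 1..<n + 1] = Some s"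
    by (auto simp: naples_spot_def check_order_def find_append split: option.splits
        simp del: upt_Suc)
  also have "\<dots> \<longleftrightarrow> s = a \<and> a \<notin> occ \<or>
      a \<in> occ \<and> ?m \<le> s \<and> s < a \<and> s \<notin> occ \<and> {s<..<a} \<subseteq> occ \<or>
      a \<in> occ \<and> {?m..<a} \<subseteq> occ \<and> a < s \<and> s \<le> n \<and> s \<notin> occ \<and> {a<..<s} \<subseteq> occ"
  proof -
    have "{a + 1..<s} = {a<..<s}" by auto
    then show ?thesis
      unfolding none find_rev_upt_eq_Some_iff find_upt_eq_Some_iff
      by (simp add: subset_eq less_Suc_eq_le Suc_le_eq)
  qed
  finally have spot: "naples_spot n k occ a = Some s \<longleftrightarrow> s = a \<and> a \<notin> occ \<or>
      a \<in> occ \<and> ?m \<le> s \<and> s < a \<and> s \<notin> occ \<and> {s<..<a} \<subseteq> occ \<or>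
      a \<in> occ \<and> {?m..<a} \<subseteq> occ \<and> a < s \<and> s \<le> n \<and> s \<notin> occ \<and> {a<..<s} \<subseteq> occ" .
  consider "s = a" | "s < a" | "a < s" by linarith
  then show ?thesis
  proof cases
    case 1
    then show ?thesis unfolding spot using assms by auto
  next
    case 2
    then have "{s<..a} = insert a {s<..<a}" by auto
    then show ?thesis unfolding spot using assms 2 by auto
  next
    case 3
    then have "{?m..<s} = {?m..<a} \<union> insert a {a<..<s}" using assms by auto
    then show ?thesis unfolding spot using assms 3 by auto
  qed
qed

section \<open>Counting parking functions by outcome\<close>

definition preferences_to :: "nat \<Rightarrow> nat \<Rightarrow> nat set \<Rightarrow> nat \<Rightarrow> nat set" where
  "preferences_to n k occ s = {a \<in> {1..n}. naples_spot n k occ a = Some s}"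

text \<open>An arbitrary set \<open>A\<close> of free spots lets the induction remove the spot of
  the first car. With as many cars as free spots, the outcomes \<open>xs\<close> are exactly the
  orderings of \<open>A\<close>, and \<open>set (take i xs)\<close> holds the spots taken by the
  first \<open>i\<close> cars.\<close>

lemma card_all_park:
  assumes "finite A" "occ = {1..n} - A" "A \<subseteq> {1..n}"
  shows "card {\<alpha>. length \<alpha> = card A \<and> set \<alpha> \<subseteq> {1..n} \<and> all_park n k occ \<alpha>} =
    (\<Sum>xs\<in>permutations_of_set A. \<Prod>i<card A. card (preferences_to n k (occ \<union> set (take i xs)) (xs ! i)))"
  using assms
proof (induction "card A" arbitrary: A occ)
  case 0
  then show ?case by (simp add: conj_commute cong: conj_cong)
next
  case (Suc m)
  let ?F = "\<lambda>m occ. {\<alpha>. length \<alpha> = m \<and> set \<alpha> \<subseteq> {1..n} \<and> all_park n k occ \<alpha>}"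
  let ?W = "\<lambda>m occ xs. \<Prod>i<m. card (preferences_to n k (occ \<union> set (take i xs)) (xs ! i))"
  have fin: "finite (?F m occ)" for m occ
    by (rule finite_subset[OF _ finite_lists_length_eq[of "{1..n}" m]]) auto
  have IH: "card (?F m (insert s occ)) =
      (\<Sum>xs\<in>permutations_of_set (A - {s}). ?W m (insert s occ) xs)" if "s \<in> A" for s
  proof -
    have "m = card (A - {s})" "insert s occ = {1..n} - (A - {s})"
      using that Suc(2-) by auto
    then show ?thesis
      using Suc(1)[of "A - {s}" "insert s occ"] Suc(3,5) by auto
  qed
  have "?F (Suc m) occ =
      (\<Union>s\<in>A. (\<lambda>(a, \<alpha>). a # \<alpha>) ` (preferences_to n k occ s \<times> ?F m (insert s occ)))"
  proof (intro set_eqI)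
    fix \<alpha>
    show "\<alpha> \<in> ?F (Suc m) occ \<longleftrightarrow> \<alpha> \<in> (\<Union>s\<in>A. (\<lambda>(a, \<alpha>). a # \<alpha>) ` (preferences_to n k occ s \<times> ?F m (insert s occ)))"
    proof (cases \<alpha>)
      case (Cons a \<beta>)
      have "s \<in> A" if "naples_spot n k occ a = Some s" "a \<in> {1..n}" for s
        using that Suc(4) by (auto simp: naples_spot_eq_Some_iff)
      then show ?thesis
        using Cons by (auto simp: preferences_to_def image_iff split: option.splits)
    qed auto
  qed
  \<comment> \<open>The union is disjoint because the preference \<open>a\<close> determines the
    spot \<open>s\<close>.\<close>
  also have "card \<dots> = (\<Sum>s\<in>A. card (preferences_to n k occ s) * card (?F m (insert s occ)))"
  proof (subst card_UN_disjoint)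
    show "\<forall>s\<in>A. finite ((\<lambda>(a, \<alpha>). a # \<alpha>) ` (preferences_to n k occ s \<times> ?F m (insert s occ)))"
      using fin by (auto simp: preferences_to_def)
  qed (use Suc(3) in \<open>auto simp: preferences_to_def card_cartesian_product
      intro!: sum.cong card_image inj_onI trans[OF card_image]\<close>)
  \<comment> \<open>The first factor of \<open>?W\<close> becomes the factor \<open>i = 0\<close>
    for \<open>s # xs\<close>; the others shift by one, \<open>s\<close> moving from
    \<open>insert s occ\<close> into the prefix.\<close>
  also have "\<dots> = (\<Sum>s\<in>A. \<Sum>xs\<in>permutations_of_set (A - {s}). ?W (Suc m) occ (s # xs))"
    by (intro sum.cong refl) (simp add: IH sum_distrib_left prod.lessThan_Suc_shift
        del: prod.lessThan_Suc One_nat_def)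
  also have "\<dots> = (\<Sum>s\<in>A. \<Sum>xs\<in>(#) s ` permutations_of_set (A - {s}). ?W (Suc m) occ xs)"
    by (simp add: sum.reindex del: prod.lessThan_Suc)
  also have "\<dots> = (\<Sum>xs\<in>permutations_of_set A. ?W (Suc m) occ xs)"
  proof -
    have "A \<noteq> {}" using Suc(2) by auto
    then show ?thesis
      using Suc(3) by (subst permutations_of_set_nonempty[of A], simp, subst sum.UNION_disjoint) auto
  qed
  finally show ?case
    using Suc(2) by simp
qed

lemma sum_permutations_of_set_eq_sum_permutes:
  fixes n :: nat
  shows "(\<Sum>xs\<in>permutations_of_set {1..n}. f xs) =
    (\<Sum>\<tau> | \<tau> permutes {1..n}. f (map \<tau> [1..<n + 1]))"
proof (rule sum.reindex_bij_betw[symmetric])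
  let ?h = "\<lambda>\<tau>. map \<tau> [1..<n + 1]"
  have inj: "inj_on ?h {\<tau>. \<tau> permutes {1..n}}"
  proof (rule inj_onI)
    fix \<sigma> \<tau> assume *: "\<sigma> \<in> {\<tau>. \<tau> permutes {1..n}}" "\<tau> \<in> {\<tau>. \<tau> permutes {1..n}}" "?h \<sigma> = ?h \<tau>"
    then have "\<forall>i\<in>{1..n}. \<sigma> i = \<tau> i" by (auto simp: less_Suc_eq_le)
    with * show "\<sigma> = \<tau>" by (intro ext) (metis mem_Collect_eq permutes_not_in)
  qed
  have sub: "?h ` {\<tau>. \<tau> permutes {1..n}} \<subseteq> permutations_of_set {1..n}"
  proof (intro subsetI)
    fix xs assume "xs \<in> ?h ` {\<tau>. \<tau> permutes {1..n}}"
    then obtain \<tau> where \<tau>: "\<tau> permutes {1..n}" "xs = ?h \<tau>" by auto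
    have "{1..<n + 1} = {1..n}" by auto
    with \<tau> show "xs \<in> permutations_of_set {1..n}"
      by (auto simp: permutations_of_set_def distinct_map permutes_inj_on permutes_image
          simp del: upt_Suc)
  qed
  \<comment> \<open>Surjectivity follows by counting, as both sets have \<open>n!\<close>
    elements.\<close>
  have "card (?h ` {\<tau>. \<tau> permutes {1..n}}) = card (permutations_of_set {1..n})"
    using inj by (simp add: card_image card_permutations)
  with inj sub show "bij_betw ?h {\<tau>. \<tau> permutes {1..n}} (permutations_of_set {1..n})"
    by (simp add: bij_betw_def card_subset_eq)
qed

section \<open>Block lengths as conditions on intervals\<close>

text \<open>A block ending at \<open>i - 1\<close> that stays below \<open>\<sigma> i\<close> keeps
  this property when shortened, so comparing with the maximum amounts to testing a single
  block.\<close>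

lemma left_len_ge_iff:
  assumes "1 \<le> j" "j \<le> i"
  shows "i - j \<le> left_len i \<sigma> \<longleftrightarrow> (\<forall>t. j \<le> t \<and> t < i \<longrightarrow> \<sigma> t < \<sigma> i)"
    and "left_len i \<sigma> \<le> i - 1"
proof -
  let ?S = "{i - j | j. 1 \<le> j \<and> j \<le> i \<and> (\<forall>t. j \<le> t \<and> t < i \<longrightarrow> \<sigma> t < \<sigma> i)}"
  have fin: "finite ?S" by (rule finite_subset[of _ "{..i}"]) auto
  have "0 \<in> ?S" using assms by (auto intro!: exI[of _ i])
  then have "left_len i \<sigma> \<in> ?S"
    unfolding left_len_def using fin by (intro Max_in) auto
  then obtain j0 where j0: "left_len i \<sigma> = i - j0" "1 \<le> j0" "j0 \<le> i"
    "\<forall>t. j0 \<le> t \<and> t < i \<longrightarrow> \<sigma> t < \<sigma> i" by blast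
  then show "left_len i \<sigma> \<le> i - 1" by simp
  show "i - j \<le> left_len i \<sigma> \<longleftrightarrow> (\<forall>t. j \<le> t \<and> t < i \<longrightarrow> \<sigma> t < \<sigma> i)"
  proof
    assume "i - j \<le> left_len i \<sigma>"
    then have "j0 \<le> j" using j0 assms by linarith
    then show "\<forall>t. j \<le> t \<and> t < i \<longrightarrow> \<sigma> t < \<sigma> i" using j0(4) by auto
  next
    assume "\<forall>t. j \<le> t \<and> t < i \<longrightarrow> \<sigma> t < \<sigma> i"
    then show "i - j \<le> left_len i \<sigma>"
      unfolding left_len_def using fin assms by (intro Max_ge) auto
  qed
qed

text \<open>Again by closure under shortening. The inequality is strict because
  \<open>right_len\<close> counts position \<open>i\<close> itself, so the longest block ends at
  \<open>i + right_len n k i \<sigma> - 1\<close>.\<close>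

lemma less_add_right_len_iff:
  assumes "i \<le> a" "i \<le> n"
  shows "a < i + right_len n k i \<sigma> \<longleftrightarrow>
    a \<le> i + k \<and> a \<le> n \<and> (\<forall>t. i \<le> t \<and> t \<le> a \<longrightarrow> \<sigma> t \<le> \<sigma> i)"
proof -
  let ?S = "{r - i + 1 | r. i \<le> r \<and> r \<le> i + k \<and> r \<le> n \<and> (\<forall>t. i \<le> t \<and> t \<le> r \<longrightarrow> \<sigma> t \<le> \<sigma> i)}"
  have fin: "finite ?S" by (rule finite_subset[of _ "{..n + 1}"]) auto
  have "1 \<in> ?S" using assms by (auto intro!: exI[of _ i])
  then have "right_len n k i \<sigma> \<in> ?S"
    unfolding right_len_def using fin by (intro Max_in) auto
  then obtain r where r: "right_len n k i \<sigma> = r - i + 1" "i \<le> r" "r \<le> i + k" "r \<le> n"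
    "\<forall>t. i \<le> t \<and> t \<le> r \<longrightarrow> \<sigma> t \<le> \<sigma> i" by blast
  show ?thesis
  proof
    assume "a < i + right_len n k i \<sigma>"
    then have "a \<le> r" using r by linarith
    then show "a \<le> i + k \<and> a \<le> n \<and> (\<forall>t. i \<le> t \<and> t \<le> a \<longrightarrow> \<sigma> t \<le> \<sigma> i)" using r by auto
  next
    assume "a \<le> i + k \<and> a \<le> n \<and> (\<forall>t. i \<le> t \<and> t \<le> a \<longrightarrow> \<sigma> t \<le> \<sigma> i)"
    then have "a - i + 1 \<le> right_len n k i \<sigma>"
      unfolding right_len_def using fin assms by (intro Max_ge) auto
    then show "a < i + right_len n k i \<sigma>" by linarith
  qed
qed

text \<open>The two cases of \<open>ell\<close> come from spot 1. If the occupied run left of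
  \<open>i\<close> reaches it, every \<open>a < i\<close> leads forward to \<open>i\<close>;
  otherwise \<open>a - k\<close> must lie in that run, which costs \<open>k\<close> of its
  \<open>left_len i \<sigma>\<close> positions.\<close>

lemma card_preferences_to:
  assumes \<sigma>: "\<sigma> permutes {1..n}" and i: "i \<in> {1..n}"
  shows "card (preferences_to n k {t \<in> {1..n}. \<sigma> t < \<sigma> i} i) = ell n k i \<sigma>"
proof -
  let ?occ = "{t \<in> {1..n}. \<sigma> t < \<sigma> i}"
  define L where "L = left_len i \<sigma>"
  define R where "R = right_len n k i \<sigma>"
  \<comment> \<open>Threshold for the forward preferences. It may be \<open>i\<close> or more; then
    \<open>{lo..<i}\<close> is empty, in agreement with the truncated \<open>L - k\<close>.\<close>
  define lo where "lo = (if L = i - 1 then 1 else i - L + k)"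
  have L: "L \<le> i - 1" "\<And>j. 1 \<le> j \<Longrightarrow> j \<le> i \<Longrightarrow> i - j \<le> L \<longleftrightarrow> {j..<i} \<subseteq> ?occ"
    using i left_len_ge_iff[of _ i \<sigma>] unfolding L_def by (auto simp: subset_iff)
  \<comment> \<open>Reconciles the weak inequality in \<open>right_len\<close> with the strict one
    in \<open>?occ\<close>: by injectivity they differ only at the free spot
    \<open>i\<close>.\<close>
  have less_iff: "\<sigma> t < \<sigma> i \<longleftrightarrow> \<sigma> t \<le> \<sigma> i \<and> t \<noteq> i" for t
    using permutes_inj[OF \<sigma>] by (auto simp: order.order_iff_strict dest: injD)
  have backward: "a \<le> n \<and> a \<le> i + k \<and> {i<..a} \<subseteq> ?occ \<longleftrightarrow> a < i + R" if "i \<le> a" for a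
  proof -
    have "{i<..a} \<subseteq> ?occ \<longleftrightarrow> (\<forall>t. i \<le> t \<and> t \<le> a \<longrightarrow> \<sigma> t \<le> \<sigma> i)" if "a \<le> n"
      unfolding subset_iff less_iff using that i by (auto simp: le_less[of i])
    then show ?thesis
      using that i unfolding R_def by (subst less_add_right_len_iff) auto
  qed
  have onward: "1 \<le> a \<and> {max 1 (a - k)..<i} \<subseteq> ?occ \<longleftrightarrow> lo \<le> a" if "a < i" for a
  proof -
    have "{max 1 (a - k)..<i} \<subseteq> ?occ \<longleftrightarrow> i - max 1 (a - k) \<le> L"
      using that i by (intro L(2)[symmetric]) auto
    then show ?thesis using L(1) that i unfolding lo_def by auto
  qed
  have "preferences_to n k ?occ i = {lo..<i} \<union> {i..<i + R}"
  proof (intro set_eqI)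
    fix a
    have "lo \<ge> 1" using L(1) i by (auto simp: lo_def)
    moreover have "i < i + R" using backward[of i] i by auto
    ultimately show "a \<in> preferences_to n k ?occ i \<longleftrightarrow> a \<in> {lo..<i} \<union> {i..<i + R}"
      using i backward[of a] onward[of a]
      by (cases "a < i") (auto simp: preferences_to_def naples_spot_eq_Some_iff simp del: One_nat_def del: subsetI)
  qed
  moreover have "card \<dots> = (i - lo) + R"
    by (subst card_Un_disjoint) auto
  ultimately show ?thesis
    using L(1) i by (auto simp: ell_def lo_def simp flip: L_def R_def)
qed

section \<open>From outcomes to permutations\<close>

theorem theorem3p13:
  fixes n k :: nat
  assumes "n \<ge> 1" and "k \<le> n - 1"
  shows "card (PF n k) = (\<Sum>\<sigma> | \<sigma> permutes {1..n}. \<Prod>i = 1..n. ell n k i \<sigma>)"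
proof -
  let ?w = "\<lambda>\<tau> j. card (preferences_to n k (\<tau> ` {1..<j}) (\<tau> j))"
  have "card (PF n k) = (\<Sum>xs\<in>permutations_of_set {1..n}.
      \<Prod>i<n. card (preferences_to n k (set (take i xs)) (xs ! i)))"
    using card_all_park[of "{1..n}" "{}" n k]
    by (simp add: PF_def parking_preferences_def conj_assoc)
  also have "\<dots> = (\<Sum>\<tau> | \<tau> permutes {1..n}. \<Prod>i<n. ?w \<tau> (Suc i))"
    unfolding sum_permutations_of_set_eq_sum_permutes
    by (intro sum.cong prod.cong refl) (simp add: take_map del: upt_Suc)
  also have "\<dots> = (\<Sum>\<tau> | \<tau> permutes {1..n}. \<Prod>j = 1..n. ?w \<tau> j)"
    by (intro sum.cong refl prod.reindex_bij_witness[of _ "\<lambda>j. j - 1" Suc]) auto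
  \<comment> \<open>Passes to \<open>\<sigma>\<close>, which sends spots to cars, since
    \<open>ell\<close> reads the arrival order along the street.\<close>
  also have "\<dots> = (\<Sum>\<sigma> | \<sigma> permutes {1..n}. \<Prod>j = 1..n. ?w (inv \<sigma>) j)"
    by (rule sum_permutations_inverse)
  also have "\<dots> = (\<Sum>\<sigma> | \<sigma> permutes {1..n}. \<Prod>i = 1..n. ell n k i \<sigma>)"
  proof (intro sum.cong refl)
    fix \<sigma> assume "\<sigma> \<in> {\<sigma>. \<sigma> permutes {1..n}}"
    then have \<sigma>: "\<sigma> permutes {1..n}" by simp
    \<comment> \<open>Reindexes the factors by the spot \<open>i\<close> of car
      \<open>j = \<sigma> i\<close>.\<close>
    have "(\<Prod>j = 1..n. ?w (inv \<sigma>) j) = (\<Prod>i = 1..n. ?w (inv \<sigma>) (\<sigma> i))"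
      using prod.permute[OF \<sigma>, of "?w (inv \<sigma>)"] by (simp add: comp_def)
    also have "\<dots> = (\<Prod>i = 1..n. ell n k i \<sigma>)"
    proof (intro prod.cong refl)
      fix i assume i: "i \<in> {1..n}"
      have "inv \<sigma> ` {1..<\<sigma> i} = {t \<in> {1..n}. \<sigma> t < \<sigma> i}"
      proof -
        have "\<sigma> i \<le> n" using permutes_in_image[OF \<sigma>, of i] i by auto
        have "inv \<sigma> ` {1..<\<sigma> i} = \<sigma> -` {1..<\<sigma> i}"
          using bij_vimage_eq_inv_image[OF permutes_bij[OF \<sigma>]] by simp
        also have "\<dots> = {t \<in> {1..n}. \<sigma> t < \<sigma> i}"
          using permutes_in_image[OF \<sigma>] \<open>\<sigma> i \<le> n\<close> by fastforce
        finally show ?thesis .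
      qed
      then show "?w (inv \<sigma>) (\<sigma> i) = ell n k i \<sigma>"
        using card_preferences_to[OF \<sigma> i] permutes_inverses(2)[OF \<sigma>] by simp
    qed
    finally show "(\<Prod>j = 1..n. ?w (inv \<sigma>) j) = (\<Prod>i = 1..n. ell n k i \<sigma>)" .
  qed
  finally show ?thesis .
qed

end
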